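(* Let $A$ be a finite-dimensional perm algebra, let $\mathfrak{R}=\sum_ia_i\otimes\bar a_i\in A\otimes A$ be symmetric, and let $\Delta:A\to A\otimes A$ be the linear map $$\Delta(a)=(\mathfrak{l}_A(a)\otimes\mathrm{id}+\mathrm{id}\otimes\mathfrak{l}_A(a)-\mathrm{id}\otimes\mathfrak{r}_A(a))\mathfrak{R}.$$ If $$P(\mathfrak{R})=\mathfrak{R}_{13}\mathfrak{R}_{12}-\mathfrak{R}_{13}\mathfrak{R}_{23}+[\mathfrak{R}_{23},\mathfrak{R}_{12}]=0,$$ then $(A,\Delta)$ is a perm bialgebra.
   Context: All vector spaces are finite-dimensional over a field $\mathbb{K}$ of characteristic zero. A perm algebra is a vector space with a bilinear product satisfying $(a_1a_2)a_3=a_1(a_2a_3)=a_1(a_3a_2)$ (no unit is required). $\mathfrak{l}_A(x)(y)=xy$, $\mathfrak{r}_A(x)(y)=yx$, $\tau(x\otimes y)=y\otimes x$; $\mathfrak{R}$ is symmetric if $\tau\mathfrak{R}=\mathfrak{R}$. In $A\otimes A\otimes A$: $\mathfrak{R}_{13}\mathfrak{R}_{12}=\sum_{i,j}a_ia_j\otimes\bar a_j\otimes\bar a_i$, $\mathfrak{R}_{13}\mathfrak{R}_{23}=\sum_{i,j}a_i\otimes a_j\otimes\bar a_i\bar a_j$, $\mathfrak{R}_{23}\mathfrak{R}_{12}=\sum_{i,j}a_j\otimes a_i\bar a_j\otimes\bar a_i$, $\mathfrak{R}_{12}\mathfrak{R}_{23}=\sum_{i,j}a_i\otimes\bar a_ia_j\otimes\bar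 a_j$, and $[\mathfrak{R}_{23},\mathfrak{R}_{12}]=\mathfrak{R}_{23}\mathfrak{R}_{12}-\mathfrak{R}_{12}\mathfrak{R}_{23}$. (The equation $P(\mathfrak{R})=0$ is called the $\mathcal{S}$-equation in $A$.) Perm bialgebra: $(A,\Delta)$ with $\Delta:A\to A\otimes A$ linear such that $(\Delta\otimes\mathrm{id})\Delta=(\mathrm{id}\otimes\Delta)\Delta=(\mathrm{id}\otimes\tau\Delta)\Delta$ and for all $a_1,a_2\in A$: $$\Delta(a_1a_2)-\tau\Delta(a_1a_2)=\Delta(a_2a_1)-\tau\Delta(a_2a_1)$$ $$=(\mathfrak{r}_A(a_2)\otimes\mathrm{id})\Delta(a_1)-\tau(\mathrm{id}\otimes\mathfrak{r}_A(a_2))\Delta(a_1)+(\mathrm{id}\otimes\mathfrak{r}_A(a_1))\Delta(a_2)-\tau(\mathfrak{r}_A(a_1)\otimes\mathrm{id})\Delta(a_2),$$ and $$\Delta(a_1a_2)=(\mathfrak{l}_A(a_1)\otimes\mathrm{id})\Delta(a_2)+(\mathrm{id}\otimes\mathfrak{r}_A(a_2))\Delta(a_1)-(\mathrm{id}\otimes\mathfrak{l}_A(a_2))\Delta(a_1)$$ $$=(\mathfrak{l}_A(a_1)\otimes\mathrm{id})\Delta(a_2)-\tau(\mathrm{id}\otimes\mathfrak{l}_A(a_1))\Delta(a_2)+(\mathrm{id}\otimes\mathfrak{r}_A(a_2))\Delta(a_1)$$ $$=(\mathfrak{r}_A(a_2)\otimes\mathrm{id})\Delta(a_1)+(\mathrm{id}\otimes\mathfrak{r}_A(a_1))\Delta(a_2)-(\mathrm{id}\otimes\mathfrak{l}_A(a_1))\Delta(a_2)-\tau(\mathfrak{r}_A(a_1)\otimes\mathrm{id})\Delta(a_2)+\tau(\mathfrak{l}_A(a_1)\otimes\mathrm{id})\Delta(a_2).$$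 *)

theory Defs
  imports Complex_Main "HOL-Library.Function_Algebras"
begin

section \<open>Tensor powers of a vector space\<close>

text \<open>
  For a vector space \<open>A\<close> (type \<open>'a\<close>, scalar multiplication \<open>s\<close>) over \<open>'k\<close>, a tensor in
  \<open>A \<otimes> A\<close> is represented by the bilinear form on the dual space that it induces:
  \<open>x \<otimes> y\<close> is the form sending \<open>(\<phi>, \<psi>)\<close> to \<open>\<phi> x * \<psi> y\<close>, and \<open>A \<otimes> A\<close> is the span of these
  forms. To make equality of tensors plain equality of functions, all forms vanish on
  arguments that are not linear functionals. Threefold tensors are treated in the same way.
  The universal properties are \<open>tens2_universal\<close> and \<open>tens3_universal\<close> below. Sums and
  differences of tensors are the pointwise ones of \<open>HOL-Library.Function_Algebras\<close>.
\<close>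

type_synonym ('k, 'a) form2 = "('a \<Rightarrow> 'k) \<Rightarrow> ('a \<Rightarrow> 'k) \<Rightarrow> 'k"
type_synonym ('k, 'a) form3 = "('a \<Rightarrow> 'k) \<Rightarrow> ('a \<Rightarrow> 'k) \<Rightarrow> ('a \<Rightarrow> 'k) \<Rightarrow> 'k"

definition dual :: "('k::field \<Rightarrow> 'a::ab_group_add \<Rightarrow> 'a) \<Rightarrow> ('a \<Rightarrow> 'k) set" where
  "dual s = {\<phi>. Vector_Spaces.linear s (*) \<phi>}"

definition scale2 :: "'k::field \<Rightarrow> ('k, 'a) form2 \<Rightarrow> ('k, 'a) form2" where
  "scale2 c T = (\<lambda>\<phi> \<psi>. c * T \<phi> \<psi>)"

definition scale3 :: "'k::field \<Rightarrow> ('k, 'a) form3 \<Rightarrow> ('k, 'a) form3" where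
  "scale3 c T = (\<lambda>\<phi> \<psi> \<chi>. c * T \<phi> \<psi> \<chi>)"

definition tens2 ::
  "('k::field \<Rightarrow> 'a::ab_group_add \<Rightarrow> 'a) \<Rightarrow> 'a \<Rightarrow> 'a \<Rightarrow> ('k, 'a) form2" where
  "tens2 s x y = (\<lambda>\<phi> \<psi>. if \<phi> \<in> dual s \<and> \<psi> \<in> dual s then \<phi> x * \<psi> y else 0)"

definition tens3 ::
  "('k::field \<Rightarrow> 'a::ab_group_add \<Rightarrow> 'a) \<Rightarrow> 'a \<Rightarrow> 'a \<Rightarrow> 'a \<Rightarrow> ('k, 'a) form3" where
  "tens3 s x y z = (\<lambda>\<phi> \<psi> \<chi>.
     if \<phi> \<in> dual s \<and> \<psi> \<in> dual s \<and> \<chi> \<in> dual s then \<phi> x * \<psi> y * \<chi> z else 0)"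

definition tensor_square ::
  "('k::field \<Rightarrow> 'a::ab_group_add \<Rightarrow> 'a) \<Rightarrow> ('k, 'a) form2 set" where
  "tensor_square s = module.span scale2 {tens2 s x y |x y. True}"

definition tensor_cube ::
  "('k::field \<Rightarrow> 'a::ab_group_add \<Rightarrow> 'a) \<Rightarrow> ('k, 'a) form3 set" where
  "tensor_cube s = module.span scale3 {tens3 s x y z |x y z. True}"

definition flip :: "('k, 'a) form2 \<Rightarrow> ('k, 'a) form2" where
  "flip T = (\<lambda>\<phi> \<psi>. T \<psi> \<phi>)"

text \<open>\<open>tmap s f g\<close> is \<open>f \<otimes> g\<close> for linear endomorphisms \<open>f, g\<close> of \<open>A\<close>; see \<open>tmap_tens2\<close>.\<close>

definition tmap ::
  "('k::field \<Rightarrow> 'a::ab_group_add \<Rightarrow> 'a) \<Rightarrow> ('a \<Rightarrow> 'a) \<Rightarrow> ('a \<Rightarrow> 'a)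
     \<Rightarrow> ('k, 'a) form2 \<Rightarrow> ('k, 'a) form2" where
  "tmap s f g T = (\<lambda>\<phi> \<psi>. if \<phi> \<in> dual s \<and> \<psi> \<in> dual s then T (\<phi> \<circ> f) (\<psi> \<circ> g) else 0)"

text \<open>
  For a linear map \<open>D\<close> from \<open>A\<close> to \<open>A \<otimes> A\<close>, \<open>map_left D\<close> is \<open>D \<otimes> id\<close> and \<open>map_right D\<close> is
  \<open>id \<otimes> D\<close>, both from \<open>A \<otimes> A\<close> to \<open>A \<otimes> A \<otimes> A\<close>; see \<open>map_left_tens2\<close> and \<open>map_right_tens2\<close>.
\<close>

definition map_left :: "('a \<Rightarrow> ('k, 'a) form2) \<Rightarrow> ('k, 'a) form2 \<Rightarrow> ('k, 'a) form3" where
  "map_left D T = (\<lambda>\<phi> \<psi> \<chi>. T (\<lambda>x. D x \<phi> \<psi>) \<chi>)"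

definition map_right :: "('a \<Rightarrow> ('k, 'a) form2) \<Rightarrow> ('k, 'a) form2 \<Rightarrow> ('k, 'a) form3" where
  "map_right D T = (\<lambda>\<phi> \<psi> \<chi>. T \<phi> (\<lambda>x. D x \<psi> \<chi>))"


subsection \<open>Universal properties\<close>

lemma vector_space_scale2: "vector_space scale2"
  by unfold_locales (auto simp: scale2_def fun_eq_iff algebra_simps)

lemma vector_space_scale3: "vector_space scale3"
  by unfold_locales (auto simp: scale3_def fun_eq_iff algebra_simps)

lemma dualD:
  assumes "\<phi> \<in> dual s"
  shows "\<phi> (x + y) = \<phi> x + \<phi> y" "\<phi> (s c x) = c * \<phi> x"
proof -
  interpret Vector_Spaces.linear s "(*)" \<phi> using assms by (simp add: dual_def)
  show "\<phi> (x + y) = \<phi> x + \<phi> y" "\<phi> (s c x) = c * \<phi> x" by (simp_all add: add scale)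
qed

lemma linear_tens2:
  assumes "vector_space s"
  shows "Vector_Spaces.linear s scale2 (tens2 s x)"
    and "Vector_Spaces.linear s scale2 (\<lambda>x. tens2 s x y)"
  using assms vector_space_scale2
  by (auto simp: Vector_Spaces.linear_iff fun_eq_iff tens2_def scale2_def dualD algebra_simps)

lemma linear_tens3:
  assumes "vector_space s"
  shows "Vector_Spaces.linear s scale3 (tens3 s x y)"
    and "Vector_Spaces.linear s scale3 (\<lambda>y. tens3 s x y z)"
    and "Vector_Spaces.linear s scale3 (\<lambda>x. tens3 s x y z)"
  using assms vector_space_scale3
  by (auto simp: Vector_Spaces.linear_iff fun_eq_iff tens3_def scale3_def dualD algebra_simps)

lemma linear_sum_scale:
  assumes "Vector_Spaces.linear s t f"
  shows "f (\<Sum>b\<in>B. s (r b) (g b)) = (\<Sum>b\<in>B. t (r b) (f (g b)))"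
proof -
  interpret Vector_Spaces.linear s t f by fact
  show ?thesis by (simp add: sum scale)
qed

lemma (in finite_dimensional_vector_space) coordinates:
  shows "(\<lambda>x. representation Basis x b) \<in> dual scale"
    and "(\<Sum>b\<in>Basis. scale (representation Basis x b) b) = x"
proof -
  have "x \<in> span Basis" for x by (simp add: span_Basis)
  moreover have "vector_space ((*) :: 'a \<Rightarrow> 'a \<Rightarrow> 'a)"
    by unfold_locales (simp_all add: algebra_simps)
  ultimately show "(\<lambda>x. representation Basis x b) \<in> dual scale"
    by (simp add: dual_def Vector_Spaces.linear_iff vector_space_axioms representation_add
        representation_scale independent_Basis)
  show "(\<Sum>b\<in>Basis. scale (representation Basis x b) b) = x"
    by (rule sum_representation_eq[OF independent_Basis])
      (auto simp: span_Basis finite_Basis)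
qed

lemma tens2_universal:
  assumes "finite_dimensional_vector_space s Basis" and "vector_space t"
    and h: "\<And>x. Vector_Spaces.linear s t (h x)" "\<And>y. Vector_Spaces.linear s t (\<lambda>x. h x y)"
  shows "\<exists>L. Vector_Spaces.linear scale2 t L \<and> (\<forall>x y. L (tens2 s x y) = h x y)"
    and "\<lbrakk>Vector_Spaces.linear scale2 t L; Vector_Spaces.linear scale2 t L';
          \<forall>x y. L (tens2 s x y) = h x y; \<forall>x y. L' (tens2 s x y) = h x y;
          T \<in> tensor_square s\<rbrakk> \<Longrightarrow> L T = L' T"
proof -
  interpret A: finite_dimensional_vector_space s Basis by fact
  interpret V: vector_space t by fact
  define r where "r b x = A.representation Basis x b" for b x
  note r = A.coordinates[folded r_def]
  define L0 where "L0 T = (\<Sum>b\<in>Basis. \<Sum>c\<in>Basis. t (T (r b) (r c)) (h b c))" for T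
  have "Vector_Spaces.linear scale2 t L0"
    by (simp add: Vector_Spaces.linear_iff vector_space_scale2 V.vector_space_axioms L0_def
        scale2_def V.scale_left_distrib sum.distrib V.scale_sum_right)
  moreover have "L0 (tens2 s x y) = h x y" for x y
  proof -
    have "h x y = (\<Sum>b\<in>Basis. t (r b x) (h b y))"
      using linear_sum_scale[OF h(2), of "\<lambda>b. r b x" "\<lambda>b. b" Basis y] by (simp add: r)
    also have "\<dots> = (\<Sum>b\<in>Basis. \<Sum>c\<in>Basis. t (r b x * r c y) (h b c))"
    proof (rule sum.cong[OF refl])
      fix b
      show "t (r b x) (h b y) = (\<Sum>c\<in>Basis. t (r b x * r c y) (h b c))"
        using linear_sum_scale[OF h(1), of b "\<lambda>b. r b y" "\<lambda>b. b" Basis]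
        by (simp add: r V.scale_sum_right)
    qed
    finally show ?thesis by (simp add: L0_def tens2_def r)
  qed
  ultimately show "\<exists>L. Vector_Spaces.linear scale2 t L \<and> (\<forall>x y. L (tens2 s x y) = h x y)"
    by blast
next
  assume L: "Vector_Spaces.linear scale2 t L" "Vector_Spaces.linear scale2 t L'"
    and eq: "\<forall>x y. L (tens2 s x y) = h x y" "\<forall>x y. L' (tens2 s x y) = h x y"
    and T: "T \<in> tensor_square s"
  interpret vector_space_pair scale2 t
    by (simp add: vector_space_pair_def vector_space_scale2 assms)
  show "L T = L' T"
    by (rule linear_eq_on[OF L T[unfolded tensor_square_def]]) (auto simp: eq)
qed

lemma tens3_universal:
  assumes "finite_dimensional_vector_space s Basis" and "vector_space t"
    and h: "\<And>x y. Vector_Spaces.linear s t (h x y)"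
      "\<And>x z. Vector_Spaces.linear s t (\<lambda>y. h x y z)"
      "\<And>y z. Vector_Spaces.linear s t (\<lambda>x. h x y z)"
  shows "\<exists>L. Vector_Spaces.linear scale3 t L \<and> (\<forall>x y z. L (tens3 s x y z) = h x y z)"
    and "\<lbrakk>Vector_Spaces.linear scale3 t L; Vector_Spaces.linear scale3 t L';
          \<forall>x y z. L (tens3 s x y z) = h x y z; \<forall>x y z. L' (tens3 s x y z) = h x y z;
          T \<in> tensor_cube s\<rbrakk> \<Longrightarrow> L T = L' T"
proof -
  interpret A: finite_dimensional_vector_space s Basis by fact
  interpret V: vector_space t by fact
  define r where "r b x = A.representation Basis x b" for b x
  note r = A.coordinates[folded r_def]
  define L0 where
    "L0 T = (\<Sum>b\<in>Basis. \<Sum>c\<in>Basis. \<Sum>d\<in>Basis. t (T (r b) (r c) (r d)) (h b c d))" for T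
  have "Vector_Spaces.linear scale3 t L0"
    by (simp add: Vector_Spaces.linear_iff vector_space_scale3 V.vector_space_axioms L0_def
        scale3_def V.scale_left_distrib sum.distrib V.scale_sum_right)
  moreover have "L0 (tens3 s x y z) = h x y z" for x y z
  proof -
    have 1: "h x y z = (\<Sum>b\<in>Basis. t (r b x) (h b y z))" for x y z
      using linear_sum_scale[OF h(3), of "\<lambda>b. r b x" "\<lambda>b. b" Basis y z] by (simp add: r)
    have 2: "h x y z = (\<Sum>c\<in>Basis. t (r c y) (h x c z))" for x y z
      using linear_sum_scale[OF h(2), of x "\<lambda>b. r b y" "\<lambda>b. b" Basis z] by (simp add: r)
    have 3: "h x y z = (\<Sum>d\<in>Basis. t (r d z) (h x y d))" for x y z
      using linear_sum_scale[OF h(1), of x y "\<lambda>b. r b z" "\<lambda>b. b" Basis] by (simp add: r)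
    have "h x y z = (\<Sum>b\<in>Basis. t (r b x) (\<Sum>c\<in>Basis. t (r c y)
        (\<Sum>d\<in>Basis. t (r d z) (h b c d))))"
      by (subst 1, subst 2, subst 3) (rule refl)
    then show ?thesis by (simp add: L0_def tens3_def r V.scale_sum_right mult.assoc)
  qed
  ultimately show "\<exists>L. Vector_Spaces.linear scale3 t L \<and> (\<forall>x y z. L (tens3 s x y z) = h x y z)"
    by blast
next
  assume L: "Vector_Spaces.linear scale3 t L" "Vector_Spaces.linear scale3 t L'"
    and eq: "\<forall>x y z. L (tens3 s x y z) = h x y z" "\<forall>x y z. L' (tens3 s x y z) = h x y z"
    and T: "T \<in> tensor_cube s"
  interpret vector_space_pair scale3 t
    by (simp add: vector_space_pair_def vector_space_scale3 assms)
  show "L T = L' T"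
    by (rule linear_eq_on[OF L T[unfolded tensor_cube_def]]) (auto simp: eq)
qed


subsection \<open>The induced maps on pure tensors\<close>

lemma linear_flip: "Vector_Spaces.linear scale2 scale2 flip"
  by (auto simp: Vector_Spaces.linear_iff vector_space_scale2 flip_def scale2_def fun_eq_iff)

lemma linear_tmap: "Vector_Spaces.linear scale2 scale2 (tmap s f g)"
  by (auto simp: Vector_Spaces.linear_iff vector_space_scale2 tmap_def scale2_def fun_eq_iff)

lemma linear_map_left: "Vector_Spaces.linear scale2 scale3 (map_left D)"
  and linear_map_right: "Vector_Spaces.linear scale2 scale3 (map_right D)"
  by (auto simp: Vector_Spaces.linear_iff vector_space_scale2 vector_space_scale3 map_left_def
      map_right_def scale2_def scale3_def fun_eq_iff)

lemma flip_tens2: "flip (tens2 s x y) = tens2 s y x"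
  by (auto simp: flip_def tens2_def fun_eq_iff)

lemma tmap_tens2:
  assumes "Vector_Spaces.linear s s f" "Vector_Spaces.linear s s g"
  shows "tmap s f g (tens2 s x y) = tens2 s (f x) (g y)"
  using Vector_Spaces.linear_compose[OF assms(1)] Vector_Spaces.linear_compose[OF assms(2)]
  by (auto simp: tmap_def tens2_def fun_eq_iff dual_def)

lemma sum_fun_apply: "(\<Sum>i\<in>I. F i) x = (\<Sum>i\<in>I. F i x)"
  by (induction I rule: infinite_finite_induct) auto

lemma dual_apply_form2:
  assumes "Vector_Spaces.linear s scale2 D"
  shows "(\<lambda>x. D x \<phi> \<psi>) \<in> dual s"
proof -
  have "vector_space ((*) :: 'a \<Rightarrow> 'a \<Rightarrow> 'a)"
    by unfold_locales (simp_all add: algebra_simps)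
  then show ?thesis
    using assms by (auto simp: dual_def Vector_Spaces.linear_iff scale2_def)
qed

lemma map_left_tens2:
  assumes "Vector_Spaces.linear s scale2 D" and "D x = (\<Sum>i\<in>I. tens2 s (p i) (q i))"
  shows "map_left D (tens2 s x y) = (\<Sum>i\<in>I. tens3 s (p i) (q i) y)"
  using dual_apply_form2[OF assms(1)]
  by (auto simp: map_left_def tens2_def tens3_def fun_eq_iff sum_fun_apply
      assms(2) sum_distrib_right intro!: sum.cong)

lemma map_right_tens2:
  assumes "Vector_Spaces.linear s scale2 D" and "D y = (\<Sum>i\<in>I. tens2 s (p i) (q i))"
  shows "map_right D (tens2 s x y) = (\<Sum>i\<in>I. tens3 s x (p i) (q i))"
  using dual_apply_form2[OF assms(1)]
  by (auto simp: map_right_def tens2_def tens3_def fun_eq_iff sum_fun_apply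
      assms(2) sum_distrib_left mult.assoc intro!: sum.cong)


section \<open>Perm algebras and perm bialgebras\<close>

locale perm_algebra = vector_space s
  for s :: "'k::field_char_0 \<Rightarrow> 'a::ab_group_add \<Rightarrow> 'a" +
  fixes m :: "'a \<Rightarrow> 'a \<Rightarrow> 'a"
  assumes linear_mult_right: "Vector_Spaces.linear s s (\<lambda>y. m x y)"
    and linear_mult_left: "Vector_Spaces.linear s s (\<lambda>x. m x y)"
    and assoc: "m (m x y) z = m x (m y z)"
    and perm: "m x (m y z) = m x (m z y)"

definition lmult :: "('a \<Rightarrow> 'a \<Rightarrow> 'a) \<Rightarrow> 'a \<Rightarrow> 'a \<Rightarrow> 'a" where
  "lmult m x = (\<lambda>y. m x y)"

definition rmult :: "('a \<Rightarrow> 'a \<Rightarrow> 'a) \<Rightarrow> 'a \<Rightarrow> 'a \<Rightarrow> 'a" where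
  "rmult m x = (\<lambda>y. m y x)"

locale perm_bialgebra = perm_algebra s m
  for s :: "'k::field_char_0 \<Rightarrow> 'a::ab_group_add \<Rightarrow> 'a" and m :: "'a \<Rightarrow> 'a \<Rightarrow> 'a" +
  fixes \<Delta> :: "'a \<Rightarrow> ('k, 'a) form2"
  assumes linear_comult: "Vector_Spaces.linear s scale2 \<Delta>"
    and comult_in: "\<Delta> x \<in> tensor_square s"
    and coassoc: "map_left \<Delta> (\<Delta> x) = map_right \<Delta> (\<Delta> x)"
    and coperm: "map_right \<Delta> (\<Delta> x) = map_right (flip \<circ> \<Delta>) (\<Delta> x)"
    and compat1: "\<Delta> (m x y) - flip (\<Delta> (m x y)) = \<Delta> (m y x) - flip (\<Delta> (m y x))"
    and compat2: "\<Delta> (m y x) - flip (\<Delta> (m y x)) =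
      tmap s (rmult m y) id (\<Delta> x) - flip (tmap s id (rmult m y) (\<Delta> x))
      + tmap s id (rmult m x) (\<Delta> y) - flip (tmap s (rmult m x) id (\<Delta> y))"
    and compat3: "\<Delta> (m x y) =
      tmap s (lmult m x) id (\<Delta> y) + tmap s id (rmult m y) (\<Delta> x)
      - tmap s id (lmult m y) (\<Delta> x)"
    and compat4: "\<Delta> (m x y) =
      tmap s (lmult m x) id (\<Delta> y) - flip (tmap s id (lmult m x) (\<Delta> y))
      + tmap s id (rmult m y) (\<Delta> x)"
    and compat5: "\<Delta> (m x y) =
      tmap s (rmult m y) id (\<Delta> x) + tmap s id (rmult m x) (\<Delta> y)
      - tmap s id (lmult m x) (\<Delta> y) - flip (tmap s (rmult m x) id (\<Delta> y))
      + flip (tmap s (lmult m x) id (\<Delta> y))"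


section \<open>The S-equation\<close>

text \<open>In what follows, \<open>R\<close> is the sum of the \<open>a i \<otimes> b i\<close> for \<open>i \<in> I\<close>.\<close>

context
  fixes s :: "'k::field \<Rightarrow> 'a::ab_group_add \<Rightarrow> 'a" and m :: "'a \<Rightarrow> 'a \<Rightarrow> 'a"
    and I :: "'i set" and a b :: "'i \<Rightarrow> 'a"
begin

definition R13_R12 :: "('k, 'a) form3" where
  "R13_R12 = (\<Sum>i\<in>I. \<Sum>j\<in>I. tens3 s (m (a i) (a j)) (b j) (b i))"

definition R13_R23 :: "('k, 'a) form3" where
  "R13_R23 = (\<Sum>i\<in>I. \<Sum>j\<in>I. tens3 s (a i) (a j) (m (b i) (b j)))"

definition R23_R12 :: "('k, 'a) form3" where
  "R23_R12 = (\<Sum>i\<in>I. \<Sum>j\<in>I. tens3 s (a j) (m (a i) (b j)) (b i))"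

definition R12_R23 :: "('k, 'a) form3" where
  "R12_R23 = (\<Sum>i\<in>I. \<Sum>j\<in>I. tens3 s (a i) (m (b i) (a j)) (b j))"

definition S_expr :: "('k, 'a) form3" where
  "S_expr = R13_R12 - R13_R23 + (R23_R12 - R12_R23)"

end

end

theory Submission
  imports Defs
begin

text \<open>
  Write \<open>L\<close> and \<open>R\<close> for left and right multiplication and \<open>[x, y] = x y - y x\<close>. In a perm
  algebra a product of three factors depends only on its first factor and on the unordered
  pair of the other two; in particular \<open>x [y, z] = 0\<close>. With a symmetric \<open>\<Sum>\<^sub>i a\<^sub>i \<otimes> b\<^sub>i\<close> this
  alone gives every compatibility between product and coproduct: once the flips have been
  removed by symmetry, each of them holds summand by summand.

  The two coalgebra identities need the S-equation \<open>P = 0\<close>. Applying \<open>L x \<otimes> id \<otimes> id\<close> makes the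
  term \<open>a\<^sub>i a\<^sub>j \<otimes> b\<^sub>j \<otimes> b\<^sub>i\<close> of \<open>P\<close> invariant under the exchange of the last two tensor factors.
  Comparing the result with its image under this exchange leaves
  \<open>\<Sum>\<^sub>i\<^sub>j x a\<^sub>i \<otimes> a\<^sub>j b\<^sub>i \<otimes> b\<^sub>j = \<Sum>\<^sub>i\<^sub>j x a\<^sub>i \<otimes> a\<^sub>j \<otimes> b\<^sub>j b\<^sub>i\<close>,
  which is \<open>mult_exchange\<close>. The permutation identity for \<open>\<Delta>\<close> is this equation together with
  \<open>a [x, b] = 0\<close>. In the coassociativity identity, the difference of the two sides is
  \<open>(id \<otimes> id \<otimes> (L x - R x)) P + (L x \<otimes> id \<otimes> id) P\<close> minus the difference of the two sides of
  \<open>mult_exchange\<close>.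
\<close>

section \<open>Coproducts of symmetric tensors\<close>

lemma tens3_diff:
  "tens3 s (x - x') y z = tens3 s x y z - tens3 s x' y z"
  "tens3 s x (y - y') z = tens3 s x y z - tens3 s x y' z"
  "tens3 s x y (z - z') = tens3 s x y z - tens3 s x y z'"
  if "vector_space s"
  using linear_tens3[OF that, unfolded linear_iff_module_hom, THEN module_hom.diff] by blast+

text \<open>A perm algebra with a symmetric element \<open>\<Sum>\<^sub>i a\<^sub>i \<otimes> b\<^sub>i\<close> of its tensor square.\<close>
locale symmetric_tensor = perm_algebra s m
  for s :: "'k::field_char_0 \<Rightarrow> 'a::ab_group_add \<Rightarrow> 'a" and m :: "'a \<Rightarrow> 'a \<Rightarrow> 'a" +
  fixes Basis :: "'a set" and I :: "'i set" and a b :: "'i \<Rightarrow> 'a"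
  assumes fin_dim: "finite_dimensional_vector_space s Basis"
    and symmetric: "flip (\<Sum>i\<in>I. tens2 s (a i) (b i)) = (\<Sum>i\<in>I. tens2 s (a i) (b i))"
begin

text \<open>
  Symmetry as an exchange of the two families in a bilinear expression; it follows from the
  universal property of the tensor square.
\<close>
lemma sum_swap_bilinear:
  assumes "vector_space t"
    and "\<And>u. Vector_Spaces.linear s t (F u)" "\<And>v. Vector_Spaces.linear s t (\<lambda>u. F u v)"
  shows "(\<Sum>i\<in>I. F (a i) (b i)) = (\<Sum>i\<in>I. F (b i) (a i))"
proof -
  obtain L where L: "Vector_Spaces.linear scale2 t L" "\<And>u v. L (tens2 s u v) = F u v"
    using tens2_universal(1)[OF fin_dim assms] by blast
  interpret L: Vector_Spaces.linear scale2 t L by fact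
  interpret flip: Vector_Spaces.linear scale2 scale2 flip by (rule linear_flip)
  have "(\<Sum>i\<in>I. F (a i) (b i)) = L (flip (\<Sum>i\<in>I. tens2 s (a i) (b i)))"
    by (simp add: symmetric L.sum L(2))
  then show ?thesis by (simp add: L.sum flip.sum flip_tens2 L(2))
qed

text \<open>The coproduct \<open>x \<mapsto> (L x \<otimes> id + id \<otimes> (L x - R x)) (\<Sum>\<^sub>i a\<^sub>i \<otimes> b\<^sub>i)\<close>.\<close>
definition comult :: "'a \<Rightarrow> ('k, 'a) form2" where
  "comult x = (\<Sum>i\<in>I. tens2 s (m x (a i)) (b i) + tens2 s (a i) (m x (b i))
    - tens2 s (a i) (m (b i) x))"

lemma tens2_add_scale:
  "tens2 s (x + x') y = tens2 s x y + tens2 s x' y"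
  "tens2 s x (y + y') = tens2 s x y + tens2 s x y'"
  "tens2 s (s c x) y = scale2 c (tens2 s x y)"
  "tens2 s x (s c y) = scale2 c (tens2 s x y)"
  using linear_tens2[OF vector_space_axioms] by (auto simp: Vector_Spaces.linear_iff)

lemma tens3_add_scale:
  "tens3 s (x + x') y z = tens3 s x y z + tens3 s x' y z"
  "tens3 s x (y + y') z = tens3 s x y z + tens3 s x y' z"
  "tens3 s x y (z + z') = tens3 s x y z + tens3 s x y z'"
  "tens3 s (s c x) y z = scale3 c (tens3 s x y z)"
  "tens3 s x (s c y) z = scale3 c (tens3 s x y z)"
  "tens3 s x y (s c z) = scale3 c (tens3 s x y z)"
  using linear_tens3[OF vector_space_axioms] by (auto simp: Vector_Spaces.linear_iff)

lemma mult_add_scale: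
  "m (x + x') y = m x y + m x' y" "m x (y + y') = m x y + m x y'"
  "m (s c x) y = s c (m x y)" "m x (s c y) = s c (m x y)"
  using linear_mult_left linear_mult_right by (auto simp: Vector_Spaces.linear_iff)

lemma mult_diff: "m (x - x') y = m x y - m x' y" "m x (y - y') = m x y - m x y'"
  by (metis add_diff_cancel_right' diff_add_cancel mult_add_scale(1))
    (metis add_diff_cancel_right' diff_add_cancel mult_add_scale(2))

lemma linear_lmult: "Vector_Spaces.linear s s (lmult m x)"
  and linear_rmult: "Vector_Spaces.linear s s (rmult m x)"
  and linear_ident: "Vector_Spaces.linear s s id"
  using linear_mult_right linear_mult_left
  by (simp_all add: lmult_def rmult_def Vector_Spaces.linear_iff vector_space_axioms)

lemma linear_comult: "Vector_Spaces.linear s scale2 comult"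
proof -
  interpret V: vector_space "scale2 :: 'k \<Rightarrow> ('k, 'a) form2 \<Rightarrow> _" by (rule vector_space_scale2)
  show ?thesis
    by (simp add: Vector_Spaces.linear_iff vector_space_axioms V.vector_space_axioms comult_def
        tens2_add_scale mult_add_scale V.scale_sum_right V.scale_right_distrib
        V.scale_right_diff_distrib algebra_simps flip: sum.distrib)
qed

lemma comult_in_tensor_square: "comult x \<in> tensor_square s"
proof -
  interpret V: vector_space "scale2 :: 'k \<Rightarrow> ('k, 'a) form2 \<Rightarrow> _" by (rule vector_space_scale2)
  show ?thesis
    unfolding comult_def tensor_square_def
    by (intro V.span_sum V.span_diff V.span_add V.span_base) auto
qed

lemma tmap_comult:
  assumes "Vector_Spaces.linear s s f" "Vector_Spaces.linear s s g"
  shows "tmap s f g (comult x) = (\<Sum>i\<in>I. tens2 s (f (m x (a i))) (g (b i))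
    + tens2 s (f (a i)) (g (m x (b i))) - tens2 s (f (a i)) (g (m (b i) x)))"
proof -
  interpret T: Vector_Spaces.linear scale2 scale2 "tmap s f g" by (rule linear_tmap)
  show ?thesis by (simp add: comult_def T.sum T.add T.diff tmap_tens2[OF assms])
qed

text \<open>
  In the flipped expression the families \<open>a\<close> and \<open>b\<close> would change sides; symmetry puts \<open>a\<close>
  back into the first tensor factor, so that it can be compared with \<open>tmap_comult\<close> summand
  by summand.
\<close>
lemma flip_tmap_comult:
  assumes fg: "Vector_Spaces.linear s s f" "Vector_Spaces.linear s s g"
  shows "flip (tmap s f g (comult x)) = (\<Sum>i\<in>I. tens2 s (g (a i)) (f (m x (b i)))
    + tens2 s (g (m x (a i))) (f (b i)) - tens2 s (g (m (a i) x)) (f (b i)))"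
proof -
  interpret V: vector_space "scale2 :: 'k \<Rightarrow> ('k, 'a) form2 \<Rightarrow> _" by (rule vector_space_scale2)
  interpret F: Vector_Spaces.linear scale2 scale2 flip by (rule linear_flip)
  interpret f: Vector_Spaces.linear s s f by fact
  interpret g: Vector_Spaces.linear s s g by fact
  let ?F = "\<lambda>u v. tens2 s (g v) (f (m x u)) + tens2 s (g (m x v)) (f u)
    - tens2 s (g (m v x)) (f u)"
  have "flip (tmap s f g (comult x)) = (\<Sum>i\<in>I. ?F (a i) (b i))"
    by (simp add: tmap_comult[OF fg] F.sum F.add F.diff flip_tens2)
  also have "\<dots> = (\<Sum>i\<in>I. ?F (b i) (a i))"
    by (rule sum_swap_bilinear[OF vector_space_scale2])
      (simp_all add: Vector_Spaces.linear_iff vector_space_axioms V.vector_space_axioms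
        f.add f.scale g.add g.scale mult_add_scale tens2_add_scale fun_eq_iff scale2_def
        algebra_simps)
  finally show ?thesis .
qed

lemma flip_comult:
  "flip (comult x) = (\<Sum>i\<in>I. tens2 s (a i) (m x (b i)) + tens2 s (m x (a i)) (b i)
    - tens2 s (m (a i) x) (b i))"
proof -
  have "tmap s id id (comult x) = comult x"
    by (subst tmap_comult) (simp_all add: linear_ident comult_def)
  with flip_tmap_comult[OF linear_ident linear_ident, of x] show ?thesis by simp
qed

lemmas linear_maps = linear_lmult linear_rmult linear_ident

text \<open>
  Rewriting with the last two equations, of which \<open>perm\<close> applies as an ordered rule, brings
  products of three factors into a normal form.
\<close>
lemmas mult_simps = comult_def lmult_def rmult_def assoc perm

lemma comult_minus_flip:
  "comult x - flip (comult x) =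
    (\<Sum>i\<in>I. tens2 s (m (a i) x) (b i) - tens2 s (a i) (m (b i) x))"
  unfolding flip_comult by (simp add: comult_def algebra_simps flip: sum_subtractf)

lemma comult_compat1:
  "comult (m x y) - flip (comult (m x y)) = comult (m y x) - flip (comult (m y x))"
  by (simp add: comult_minus_flip assoc perm)

lemma comult_compat2:
  "comult (m y x) - flip (comult (m y x)) =
    tmap s (rmult m y) id (comult x) - flip (tmap s id (rmult m y) (comult x))
    + tmap s id (rmult m x) (comult y) - flip (tmap s (rmult m x) id (comult y))"
  by (simp only: comult_minus_flip flip_tmap_comult linear_maps,
      simp only: tmap_comult linear_maps)
    (simp add: mult_simps algebra_simps flip: sum.distrib sum_subtractf)

lemma comult_compat3:
  "comult (m x y) = tmap s (lmult m x) id (comult y) + tmap s id (rmult m y) (comult x)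
    - tmap s id (lmult m y) (comult x)"
  by (simp only: tmap_comult linear_maps)
    (simp add: mult_simps algebra_simps flip: sum.distrib sum_subtractf)

lemma comult_compat4:
  "comult (m x y) = tmap s (lmult m x) id (comult y) - flip (tmap s id (lmult m x) (comult y))
    + tmap s id (rmult m y) (comult x)"
  by (simp only: flip_tmap_comult linear_maps, simp only: tmap_comult linear_maps)
    (simp add: mult_simps algebra_simps flip: sum.distrib sum_subtractf)

lemma comult_compat5:
  "comult (m x y) = tmap s (rmult m y) id (comult x) + tmap s id (rmult m x) (comult y)
    - tmap s id (lmult m x) (comult y) - flip (tmap s (rmult m x) id (comult y))
    + flip (tmap s (lmult m x) id (comult y))"
  by (simp only: flip_tmap_comult linear_maps, simp only: tmap_comult linear_maps)
    (simp add: mult_simps algebra_simps flip: sum.distrib sum_subtractf)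

lemma map_left_comult_tens2:
  "map_left comult (tens2 s x y) = (\<Sum>j\<in>I. tens3 s (m x (a j)) (b j) y
    + tens3 s (a j) (m x (b j)) y - tens3 s (a j) (m (b j) x) y)"
proof -
  have "map_left comult (tens2 s x y) \<phi> \<psi> \<chi> =
    (if \<chi> \<in> dual s then comult x \<phi> \<psi> * \<chi> y else 0)" for \<phi> \<psi> \<chi>
    using dual_apply_form2[OF linear_comult] by (simp add: map_left_def tens2_def)
  then show ?thesis
    by (auto simp: fun_eq_iff comult_def sum_fun_apply tens2_def tens3_def sum_distrib_left
        algebra_simps intro!: sum.cong)
qed

lemma map_right_comult_tens2:
  "map_right comult (tens2 s x y) = (\<Sum>j\<in>I. tens3 s x (m y (a j)) (b j)
    + tens3 s x (a j) (m y (b j)) - tens3 s x (a j) (m (b j) y))"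
proof -
  have "map_right comult (tens2 s x y) \<phi> \<psi> \<chi> =
    (if \<phi> \<in> dual s then \<phi> x * comult y \<psi> \<chi> else 0)" for \<phi> \<psi> \<chi>
    using dual_apply_form2[OF linear_comult] by (simp add: map_right_def tens2_def)
  then show ?thesis
    by (auto simp: fun_eq_iff comult_def sum_fun_apply tens2_def tens3_def sum_distrib_left
        algebra_simps intro!: sum.cong)
qed

end

section \<open>Coalgebra identities from the S-equation\<close>

text \<open>A symmetric element that solves the S-equation.\<close>
locale S_solution = symmetric_tensor s m Basis I a b
  for s :: "'k::field_char_0 \<Rightarrow> 'a::ab_group_add \<Rightarrow> 'a" and m :: "'a \<Rightarrow> 'a \<Rightarrow> 'a"
    and Basis :: "'a set" and I :: "'i set" and a b :: "'i \<Rightarrow> 'a" +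
  assumes S_equation: "S_expr s m I a b = 0"
begin

text \<open>
  The summation indices are named so that the first tensor factor of every summand involves
  \<open>a\<^sub>i\<close>, which allows a comparison of double sums summand by summand.
\<close>
lemma S_equation_sum:
  "(\<Sum>i\<in>I. \<Sum>j\<in>I. tens3 s (m (a i) (a j)) (b j) (b i) - tens3 s (a i) (a j) (m (b i) (b j))
    + tens3 s (a i) (m (a j) (b i)) (b j) - tens3 s (a i) (m (b i) (a j)) (b j)) = 0"
proof -
  have "R23_R12 s m I a b = (\<Sum>i\<in>I. \<Sum>j\<in>I. tens3 s (a i) (m (a j) (b i)) (b j))"
    unfolding R23_R12_def by (rule sum.swap)
  with S_equation show ?thesis
    by (simp add: S_expr_def R13_R12_def R13_R23_def R12_R23_def sum.distrib sum_subtractf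
        algebra_simps)
qed

text \<open>The S-equation after applying \<open>f \<otimes> g \<otimes> h\<close>.\<close>
lemma S_equation_map:
  assumes "Vector_Spaces.linear s s f" "Vector_Spaces.linear s s g" "Vector_Spaces.linear s s h"
  shows "(\<Sum>i\<in>I. \<Sum>j\<in>I. tens3 s (f (m (a i) (a j))) (g (b j)) (h (b i))
    - tens3 s (f (a i)) (g (a j)) (h (m (b i) (b j)))
    + tens3 s (f (a i)) (g (m (a j) (b i))) (h (b j))
    - tens3 s (f (a i)) (g (m (b i) (a j))) (h (b j))) = 0" (is "?S = 0")
proof -
  have "?S \<phi> \<psi> \<chi> = 0" for \<phi> \<psi> \<chi>
  proof (cases "\<phi> \<in> dual s \<and> \<psi> \<in> dual s \<and> \<chi> \<in> dual s")
    case True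
    then have "\<phi> \<circ> f \<in> dual s" "\<psi> \<circ> g \<in> dual s" "\<chi> \<circ> h \<in> dual s"
      using assms by (auto simp: dual_def intro: Vector_Spaces.linear_compose)
    with True show ?thesis
      using fun_cong[OF fun_cong[OF fun_cong[OF S_equation_sum]], of "\<phi> \<circ> f" "\<psi> \<circ> g" "\<chi> \<circ> h"]
      by (simp add: sum_fun_apply tens3_def)
  next
    case False
    then show ?thesis by (auto simp: sum_fun_apply tens3_def)
  qed
  then show ?thesis by (simp add: fun_eq_iff)
qed

text \<open>The S-equation after \<open>f \<otimes> id \<otimes> id\<close> and the exchange of the last two tensor factors.\<close>
lemma S_equation_map_flipped:
  assumes "Vector_Spaces.linear s s f"
  shows "(\<Sum>i\<in>I. \<Sum>j\<in>I. tens3 s (f (m (a i) (a j))) (b i) (b j)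
    - tens3 s (f (a i)) (m (b i) (b j)) (a j)
    + tens3 s (f (a i)) (b j) (m (a j) (b i))
    - tens3 s (f (a i)) (b j) (m (b i) (a j))) = 0" (is "?S = 0")
proof -
  have flip3: "tens3 s x y z \<phi> \<psi> \<chi> = tens3 s x z y \<phi> \<chi> \<psi>" for x y z \<phi> \<psi> \<chi>
    by (auto simp: tens3_def)
  have "?S \<phi> \<psi> \<chi> = 0" for \<phi> \<psi> \<chi>
    using fun_cong[OF fun_cong[OF fun_cong[OF S_equation_map[OF assms linear_ident linear_ident]]],
        of \<phi> \<chi> \<psi>]
    by (simp add: sum_fun_apply flip3[of _ _ _ \<phi> \<chi> \<psi>])
  then show ?thesis by (simp add: fun_eq_iff)
qed

text \<open>
  The difference of the S-equation under \<open>L x \<otimes> id \<otimes> id\<close> and its flipped form; four of the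
  remaining six terms cancel.
\<close>
lemma mult_exchange:
  "(\<Sum>i\<in>I. \<Sum>j\<in>I. tens3 s (m x (a i)) (m (a j) (b i)) (b j)
    - tens3 s (m x (a i)) (a j) (m (b j) (b i))) = 0"
proof -
  interpret V: vector_space "scale3 :: 'k \<Rightarrow> ('k, 'a) form3 \<Rightarrow> _" by (rule vector_space_scale3)
  let ?A = "\<lambda>i j. tens3 s (m x (m (a i) (a j))) (b j) (b i)"
  let ?F = "\<lambda>i u v. tens3 s (m x (a i)) v (m u (b i)) - tens3 s (m x (a i)) v (m (b i) u)
    - tens3 s (m x (a i)) (m (b i) v) u"
  \<comment> \<open>Renaming the indices and \<open>x (a\<^sub>i a\<^sub>j) = x (a\<^sub>j a\<^sub>i)\<close>.\<close>
  have A: "(\<Sum>i\<in>I. \<Sum>j\<in>I. tens3 s (m x (m (a i) (a j))) (b i) (b j)) = (\<Sum>i\<in>I. \<Sum>j\<in>I. ?A i j)"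
    by (subst sum.swap) (simp add: perm)
  \<comment> \<open>The other three terms are brought into the form of those of the unflipped equation.\<close>
  have F: "(\<Sum>j\<in>I. ?F i (a j) (b j)) = (\<Sum>j\<in>I. ?F i (b j) (a j))" for i
    by (rule sum_swap_bilinear[OF vector_space_scale3, of "?F i"])
      (simp_all add: Vector_Spaces.linear_iff vector_space_axioms V.vector_space_axioms
        mult_add_scale tens3_add_scale fun_eq_iff scale3_def algebra_simps)
  have "(\<Sum>i\<in>I. \<Sum>j\<in>I. tens3 s (m x (m (a i) (a j))) (b i) (b j) + ?F i (a j) (b j)) = 0"
    using S_equation_map_flipped[OF linear_mult_right, of x] by (simp add: algebra_simps)
  then have flipped: "(\<Sum>i\<in>I. \<Sum>j\<in>I. ?A i j + ?F i (b j) (a j)) = 0"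
    by (simp only: sum.distrib A F)
  have "(\<Sum>i\<in>I. \<Sum>j\<in>I. ?A i j - tens3 s (m x (a i)) (a j) (m (b i) (b j))
    + tens3 s (m x (a i)) (m (a j) (b i)) (b j) - tens3 s (m x (a i)) (m (b i) (a j)) (b j)) = 0"
    using S_equation_map[OF linear_mult_right linear_ident linear_ident, of x] by simp
  with flipped have "(\<Sum>i\<in>I. \<Sum>j\<in>I. (?A i j - tens3 s (m x (a i)) (a j) (m (b i) (b j))
    + tens3 s (m x (a i)) (m (a j) (b i)) (b j) - tens3 s (m x (a i)) (m (b i) (a j)) (b j))
    - (?A i j + ?F i (b j) (a j))) = 0"
    by (simp only: sum_subtractf) simp
  then show ?thesis by (simp add: algebra_simps)
qed

lemma comult_coassoc: "map_left comult (comult x) = map_right comult (comult x)"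
proof -
  interpret L: Vector_Spaces.linear scale2 scale3 "map_left comult" by (rule linear_map_left)
  interpret R: Vector_Spaces.linear scale2 scale3 "map_right comult" by (rule linear_map_right)
  let ?c = "\<lambda>u v. m u v - m v u"
  \<comment> \<open>\<open>?P1\<close> and \<open>?P2\<close> are the images of the S-equation under \<open>id \<otimes> id \<otimes> (L x - R x)\<close> and
    \<open>L x \<otimes> id \<otimes> id\<close>, and \<open>?Q\<close> is the sum in \<open>mult_exchange\<close>.\<close>
  let ?P1 = "\<lambda>i j. tens3 s (m (a i) (a j)) (b j) (?c x (b i))
    - tens3 s (a i) (a j) (?c x (m (b i) (b j)))
    + tens3 s (a i) (m (a j) (b i)) (?c x (b j)) - tens3 s (a i) (m (b i) (a j)) (?c x (b j))"
  let ?P2 = "\<lambda>i j. tens3 s (m x (m (a i) (a j))) (b j) (b i)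
    - tens3 s (m x (a i)) (a j) (m (b i) (b j))
    + tens3 s (m x (a i)) (m (a j) (b i)) (b j) - tens3 s (m x (a i)) (m (b i) (a j)) (b j)"
  let ?Q = "\<lambda>i j. tens3 s (m x (a i)) (m (a j) (b i)) (b j)
    - tens3 s (m x (a i)) (a j) (m (b j) (b i))"
  \<comment> \<open>\<open>?l1\<close> and \<open>?l2\<close> make up the left-hand side, \<open>?r\<close> the right-hand side; \<open>?l2\<close> has \<open>a\<^sub>j\<close>
    as its first factor, so its indices are exchanged below.\<close>
  let ?l1 = "\<lambda>i j. tens3 s (m (m x (a i)) (a j)) (b j) (b i)
    + tens3 s (m (a i) (a j)) (b j) (m x (b i)) - tens3 s (m (a i) (a j)) (b j) (m (b i) x)"
  let ?l2 = "\<lambda>i j. tens3 s (a j) (?c (m x (a i)) (b j)) (b i)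
    + tens3 s (a j) (?c (a i) (b j)) (m x (b i)) - tens3 s (a j) (?c (a i) (b j)) (m (b i) x)"
  let ?r = "\<lambda>i j. tens3 s (m x (a i)) (m (b i) (a j)) (b j)
    + tens3 s (m x (a i)) (a j) (?c (b i) (b j)) + tens3 s (a i) (m (?c x (b i)) (a j)) (b j)
    + tens3 s (a i) (a j) (?c (?c x (b i)) (b j))"
  note diffs = tens3_diff[OF vector_space_axioms] mult_diff
  have "Vector_Spaces.linear s s (?c x)"
    by (simp add: Vector_Spaces.linear_iff vector_space_axioms mult_add_scale
        scale_right_diff_distrib)
  then have P1: "(\<Sum>i\<in>I. \<Sum>j\<in>I. ?P1 i j) = 0"
    using S_equation_map[OF linear_ident linear_ident, of "?c x"] by simp
  have P2: "(\<Sum>i\<in>I. \<Sum>j\<in>I. ?P2 i j) = 0"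
    using S_equation_map[OF linear_mult_right linear_ident linear_ident, of x] by simp
  have "map_left comult (comult x) = (\<Sum>i\<in>I. \<Sum>j\<in>I. ?l1 i j + ?l2 i j)"
    unfolding comult_def[of x] L.sum L.add L.diff map_left_comult_tens2
    by (simp add: diffs algebra_simps flip: sum.distrib sum_subtractf)
  also have "\<dots> = (\<Sum>i\<in>I. \<Sum>j\<in>I. ?l1 i j) + (\<Sum>i\<in>I. \<Sum>j\<in>I. ?l2 i j)"
    by (simp only: sum.distrib)
  also have "(\<Sum>i\<in>I. \<Sum>j\<in>I. ?l2 i j) = (\<Sum>i\<in>I. \<Sum>j\<in>I. ?l2 j i)"
    by (rule sum.swap)
  also have "(\<Sum>i\<in>I. \<Sum>j\<in>I. ?l1 i j) + (\<Sum>i\<in>I. \<Sum>j\<in>I. ?l2 j i) =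
      (\<Sum>i\<in>I. \<Sum>j\<in>I. ?l1 i j + ?l2 j i)"
    by (simp only: sum.distrib)
  also have "\<dots> = (\<Sum>i\<in>I. \<Sum>j\<in>I. ?P1 i j + ?P2 i j - ?Q i j + ?r i j)"
    by (intro sum.cong refl) (simp add: diffs assoc perm algebra_simps)
  also have "\<dots> = (\<Sum>i\<in>I. \<Sum>j\<in>I. ?P1 i j) + (\<Sum>i\<in>I. \<Sum>j\<in>I. ?P2 i j)
      - (\<Sum>i\<in>I. \<Sum>j\<in>I. ?Q i j) + (\<Sum>i\<in>I. \<Sum>j\<in>I. ?r i j)"
    by (simp only: sum.distrib sum_subtractf)
  also have "\<dots> = (\<Sum>i\<in>I. \<Sum>j\<in>I. ?r i j)"
    by (simp only: P1 P2 mult_exchange) simp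
  also have "\<dots> = map_right comult (comult x)"
    unfolding comult_def[of x] R.sum R.add R.diff map_right_comult_tens2
    by (simp add: diffs tens3_add_scale(3) algebra_simps flip: sum.distrib sum_subtractf)
  finally show ?thesis .
qed

text \<open>This is \<open>comult_minus_flip\<close> under \<open>id \<otimes> \<Delta>\<close>.\<close>
lemma map_right_comult_minus_flip_tens2:
  "map_right comult (tens2 s x y) - map_right (flip \<circ> comult) (tens2 s x y) =
    (\<Sum>j\<in>I. tens3 s x (m (a j) y) (b j) - tens3 s x (a j) (m (b j) y))"
proof -
  have "Vector_Spaces.linear s scale2 (flip \<circ> comult)"
    by (rule Vector_Spaces.linear_compose[OF linear_comult linear_flip])
  from dual_apply_form2[OF this] dual_apply_form2[OF linear_comult]
  have "(map_right comult (tens2 s x y) - map_right (flip \<circ> comult) (tens2 s x y)) \<phi> \<psi> \<chi> =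
    (if \<phi> \<in> dual s then \<phi> x * (comult y - flip (comult y)) \<psi> \<chi> else 0)" for \<phi> \<psi> \<chi>
    by (simp add: map_right_def tens2_def algebra_simps)
  then show ?thesis
    unfolding comult_minus_flip
    by (auto simp: fun_eq_iff sum_fun_apply tens2_def tens3_def sum_distrib_left algebra_simps
        intro!: sum.cong)
qed

lemma comult_coperm: "map_right comult (comult x) = map_right (flip \<circ> comult) (comult x)"
proof -
  interpret R: Vector_Spaces.linear scale2 scale3 "map_right comult" by (rule linear_map_right)
  interpret F: Vector_Spaces.linear scale2 scale3 "map_right (flip \<circ> comult)"
    by (rule linear_map_right)
  let ?D = "\<lambda>T. map_right comult T - map_right (flip \<circ> comult) T"
  have "?D (comult x) = (\<Sum>i\<in>I. ?D (tens2 s (m x (a i)) (b i))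
      + ?D (tens2 s (a i) (m x (b i))) - ?D (tens2 s (a i) (m (b i) x)))"
    unfolding comult_def[of x] R.sum R.add R.diff F.sum F.add F.diff
    by (simp add: algebra_simps flip: sum_subtractf)
  also have "\<dots> = (\<Sum>i\<in>I. \<Sum>j\<in>I. tens3 s (m x (a i)) (m (a j) (b i)) (b j)
    - tens3 s (m x (a i)) (a j) (m (b j) (b i)))"
    \<comment> \<open>The contributions of \<open>x b\<^sub>i\<close> and \<open>b\<^sub>i x\<close> cancel, as \<open>y (x b\<^sub>i) = y (b\<^sub>i x)\<close>.\<close>
    unfolding map_right_comult_minus_flip_tens2
    by (simp add: assoc perm)
  also have "\<dots> = 0" by (rule mult_exchange)
  finally show ?thesis by simp
qed

lemma perm_bialgebra_comult: "perm_bialgebra s m comult"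
  by (rule perm_bialgebra.intro[OF perm_algebra_axioms], rule perm_bialgebra_axioms.intro)
    (fact linear_comult comult_in_tensor_square comult_coassoc comult_coperm comult_compat1
      comult_compat2 comult_compat3 comult_compat4 comult_compat5)+

end

theorem corollary4p15:
  fixes s :: "'k::field_char_0 \<Rightarrow> 'a::ab_group_add \<Rightarrow> 'a"
    and Basis :: "'a set"
    and m :: "'a \<Rightarrow> 'a \<Rightarrow> 'a"
    and I :: "'i set" and a b :: "'i \<Rightarrow> 'a"
    and R :: "('k, 'a) form2"
    and \<Delta> :: "'a \<Rightarrow> ('k, 'a) form2"
  assumes "finite_dimensional_vector_space s Basis"
    and "perm_algebra s m"
    and "finite I" and "R = (\<Sum>i\<in>I. tens2 s (a i) (b i))"
    and "flip R = R"
    and "\<And>x. \<Delta> x = tmap s (lmult m x) id R + tmap s id (lmult m x) R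
                     - tmap s id (rmult m x) R"
    and "S_expr s m I a b = 0"
  shows "perm_bialgebra s m \<Delta>"
proof -
  interpret perm_algebra s m by fact
  interpret S_solution s m Basis I a b
    using assms(1,2,5,7) unfolding assms(4)
    by (intro S_solution.intro symmetric_tensor.intro symmetric_tensor_axioms.intro
        S_solution_axioms.intro)
  have tmap_R: "tmap s f g R = (\<Sum>i\<in>I. tens2 s (f (a i)) (g (b i)))"
    if fg: "Vector_Spaces.linear s s f" "Vector_Spaces.linear s s g" for f g
  proof -
    interpret T: Vector_Spaces.linear scale2 scale2 "tmap s f g" by (rule linear_tmap)
    show ?thesis by (simp add: assms(4) T.sum tmap_tens2[OF fg])
  qed
  have "\<Delta> = comult"
    by (rule ext, simp only: assms(6) tmap_R linear_maps)
      (simp add: comult_def lmult_def rmult_def sum.distrib sum_subtractf)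
  then show ?thesis using perm_bialgebra_comult by simp
qed

end
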